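(* Let $T\in{\rm Aut}(X,\mathcal B,\mu)$ be ergodic with measure-theoretic entropy $h(T)>0$. Then the topological entropy of the topological lens $(C_2(\mu),\widetilde T)$ is $+\infty$.
   Context: $C_2(\mu)$: probability measures on $X\times X$ with both marginals $\mu$, with the compact metrizable topology $\rho_n\to\rho$ iff $\rho_n(A\times B)\to\rho(A\times B)$ for all measurable $A,B$; the topological lens is $\widetilde T(\rho)(A\times B)=\rho(T^{-1}A\times T^{-1}B)$. *)

theory Defs
  imports "HOL-Probability.Probability"
begin

definition mp_automorphism :: "'a measure \<Rightarrow> ('a \<Rightarrow> 'a) \<Rightarrow> bool" where
  "mp_automorphism M T \<longleftrightarrow>
     bij_betw T (space M) (space M) \<and>
     T \<in> measurable M M \<and> the_inv_into (space M) T \<in> measurable M M \<and>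
     distr M M T = M"

definition ergodic :: "'a measure \<Rightarrow> ('a \<Rightarrow> 'a) \<Rightarrow> bool" where
  "ergodic M T \<longleftrightarrow>
     (\<forall>A\<in>sets M. T -` A \<inter> space M = A \<longrightarrow> measure M A = 0 \<or> measure M A = 1)"

definition finite_meas_partition :: "'a measure \<Rightarrow> 'a set set \<Rightarrow> bool" where
  "finite_meas_partition M P \<longleftrightarrow>
     finite P \<and> P \<subseteq> sets M \<and> disjoint P \<and> \<Union>P = space M"

definition part_join :: "'a measure \<Rightarrow> ('a \<Rightarrow> 'a) \<Rightarrow> 'a set set \<Rightarrow> nat \<Rightarrow> 'a set set" where
  "part_join M T P n =
     {space M \<inter> (\<Inter>i<n. (T ^^ i) -` (g i)) | g. \<forall>i<n. g i \<in> P}"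

definition part_entropy :: "'a measure \<Rightarrow> 'a set set \<Rightarrow> real" where
  "part_entropy M P = - (\<Sum>A\<in>P. measure M A * ln (measure M A))"

definition ks_entropy_rel :: "'a measure \<Rightarrow> ('a \<Rightarrow> 'a) \<Rightarrow> 'a set set \<Rightarrow> real" where
  "ks_entropy_rel M T P = lim (\<lambda>n. part_entropy M (part_join M T P n) / real n)"

definition ks_entropy :: "'a measure \<Rightarrow> ('a \<Rightarrow> 'a) \<Rightarrow> ereal" where
  "ks_entropy M T = (SUP P\<in>{P. finite_meas_partition M P}. ereal (ks_entropy_rel M T P))"

definition open_cover :: "'b topology \<Rightarrow> 'b set set \<Rightarrow> bool" where
  "open_cover X U \<longleftrightarrow> (\<forall>S\<in>U. openin X S) \<and> \<Union>U = topspace X"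

definition min_subcover :: "'b topology \<Rightarrow> 'b set set \<Rightarrow> nat" where
  "min_subcover X U = (LEAST k. \<exists>V\<subseteq>U. finite V \<and> card V = k \<and> \<Union>V = topspace X)"

definition cover_join :: "'b topology \<Rightarrow> ('b \<Rightarrow> 'b) \<Rightarrow> 'b set set \<Rightarrow> nat \<Rightarrow> 'b set set" where
  "cover_join X f U n =
     {topspace X \<inter> (\<Inter>i<n. (f ^^ i) -` (g i)) | g. \<forall>i<n. g i \<in> U}"

definition top_entropy_rel :: "'b topology \<Rightarrow> ('b \<Rightarrow> 'b) \<Rightarrow> 'b set set \<Rightarrow> real" where
  "top_entropy_rel X f U = lim (\<lambda>n. ln (real (min_subcover X (cover_join X f U n))) / real n)"

definition top_entropy :: "'b topology \<Rightarrow> ('b \<Rightarrow> 'b) \<Rightarrow> ereal" where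
  "top_entropy X f = (SUP U\<in>{U. open_cover X U}. ereal (top_entropy_rel X f U))"

definition couplings2 :: "'a measure \<Rightarrow> ('a \<times> 'a) measure set" where
  "couplings2 M = {\<rho>. prob_space \<rho> \<and> sets \<rho> = sets (M \<Otimes>\<^sub>M M) \<and>
                      distr \<rho> M fst = M \<and> distr \<rho> M snd = M}"

(* rho_n \<rightarrow> rho iff rho_n(A x B) \<rightarrow> rho(A x B) for all measurable A, B:
   the coarsest topology making all rho \<mapsto> rho(A x B) continuous *)
definition couplings2_topology :: "'a measure \<Rightarrow> ('a \<times> 'a) measure topology" where
  "couplings2_topology M = topology_generated_by
     {{\<rho>\<in>couplings2 M. measure \<rho> (A \<times> B) \<in> W} | A B W.
        A \<in> sets M \<and> B \<in> sets M \<and> open (W :: real set)}"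

definition lens :: "'a measure \<Rightarrow> ('a \<Rightarrow> 'a) \<Rightarrow> ('a \<times> 'a) measure \<Rightarrow> ('a \<times> 'a) measure" where
  "lens M T \<rho> = distr \<rho> (M \<Otimes>\<^sub>M M) (\<lambda>(x, y). (T x, T y))"

end

theory Submission
  imports Defs
begin

text \<open>
  Fix a finite partition \<open>P\<close> of positive entropy and a set \<open>B\<close> in it, and let \<open>\<phi>\<^sub>i\<close> be the indicator of
  \<open>T\<^sup>-\<^sup>i B\<close> minus its conditional probability given the cells of \<open>P \<or> \<dots> \<or> T\<^sup>-\<^sup>(\<^sup>i\<^sup>-\<^sup>1\<^sup>) P\<close>. As the \<open>\<phi>\<^sub>i\<close> are
  bounded martingale differences, the Riesz product \<open>\<Prod>i<n. 1 + t\<^sub>i \<phi>\<^sub>i(x) \<phi>\<^sub>i(y)\<close> with \<open>0 \<le> t\<^sub>i \<le> 1\<close> is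
  the density of a self-coupling \<open>\<rho>\<^sub>t\<close> with respect to the product measure. If \<open>t\<close> and \<open>s\<close> first
  differ at \<open>i\<close>, then \<open>\<rho>\<^sub>t\<close> and \<open>\<rho>\<^sub>s\<close> differ on \<open>T\<^sup>-\<^sup>i B \<times> T\<^sup>-\<^sup>i B\<close> by at least
  \<open>\<bar>t\<^sub>i - s\<^sub>i\<bar> (E \<phi>\<^sub>i\<^sup>2)\<^sup>2\<close>. Positive entropy gives, for some \<open>B\<close> and \<open>v > 0\<close> and infinitely many \<open>n\<close>, at
  least \<open>v n\<close> times \<open>i < n\<close> with \<open>E \<phi>\<^sub>i\<^sup>2 \<ge> v\<close>. Letting \<open>t\<^sub>i\<close> range over \<open>L\<close> equally spaced levels at
  these times yields \<open>L\<^sup>v\<^sup>n\<close> couplings that are separated along the orbit at a scale independent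
  of \<open>n\<close>, hence entropy at least \<open>v ln L\<close>, for every \<open>L\<close>. The covers involved are finite, so that
  compactness is not needed.
\<close>

section \<open>Entropy of finite covers\<close>

text \<open>Fekete's lemma: the limit is the infimum of the quotients. If the quotient at
  \<open>N\<close> is nearly optimal, writing \<open>n\<close> as a multiple of \<open>N\<close>
  plus a remainder costs only a bounded amount. It turns the \<open>lim\<close> in
  \<open>top_entropy_rel\<close> into a genuine limit.\<close>

lemma subadditive_quotient_convergent:
  fixes a :: "nat \<Rightarrow> real"
  assumes sub: "\<And>m n. a (m + n) \<le> a m + a n" and nonneg: "\<And>n. 0 \<le> a n"
  shows "convergent (\<lambda>n. a n / real n)"
proof -
  define l where "l = (INF n\<in>{1..}. a n / real n)"
  have bdd: "bdd_below ((\<lambda>n. a n / real n) ` {1..})"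
    by (rule bdd_belowI[of _ 0]) (use nonneg in auto)
  have mult: "a (k * N + r) \<le> real k * a N + a r" for k N r
  proof (induction k)
    case (Suc k)
    have "a (Suc k * N + r) \<le> a N + a (k * N + r)"
      using sub[of N "k * N + r"] by (simp add: algebra_simps)
    with Suc show ?case by (simp add: algebra_simps)
  qed simp
  have "(\<lambda>n. a n / real n) \<longlonglongrightarrow> l"
  proof (rule LIMSEQ_I)
    fix e :: real assume "e > 0"
    have "\<exists>x\<in>(\<lambda>n. a n / real n) ` {1..}. x < l + e / 2"
      using cInf_lessD[of "(\<lambda>n. a n / real n) ` {1..}" "l + e / 2"] \<open>e > 0\<close>
      by (auto simp: l_def)
    then obtain N where N: "N \<ge> 1" "a N / real N < l + e / 2" by auto
    \<comment> \<open>A bound for \<open>a\<close> at all remainders modulo \<open>N\<close> at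
      once; it vanishes after division by \<open>n\<close>.\<close>
    define C where "C = a 0 + real N * a 1"
    obtain n0 :: nat where n0: "real n0 > 2 * C / e" using reals_Archimedean2 by blast
    show "\<exists>no. \<forall>n\<ge>no. norm (a n / real n - l) < e"
    proof (intro exI allI impI)
      \<comment> \<open>Starting at \<open>Suc n0\<close> makes \<open>n\<close> positive, so that
        its quotient takes part in the infimum.\<close>
      fix n assume n: "n \<ge> Suc n0"
      have "l \<le> a n / real n" unfolding l_def
        by (rule cINF_lower[OF bdd]) (use n in auto)
      have "a (n mod N) \<le> real (n mod N) * a 1 + a 0"
        using mult[of "n mod N" 1 0] by simp
      also have "\<dots> \<le> C" unfolding C_def
        using N nonneg[of 1] by (simp add: mult_right_mono less_imp_le)
      finally have r: "a (n mod N) \<le> C" .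
      have "real (n div N) \<le> real n / real N"
        by (rule of_nat_div_le_of_nat)
      then have "real (n div N) * a N \<le> real n / real N * a N"
        by (rule mult_right_mono) (rule nonneg)
      then have "a n \<le> real n / real N * a N + C"
        using mult[of "n div N" N "n mod N"] r by simp
      then have "a n / real n \<le> a N / real N + C / real n"
        using n N by (simp add: field_simps)
      moreover have "C / real n < e / 2"
      proof -
        have "2 * C / e < real n" using n n0 by simp
        then show ?thesis using \<open>e > 0\<close> n by (simp add: field_simps)
      qed
      ultimately show "norm (a n / real n - l) < e"
        using N \<open>l \<le> _\<close> unfolding real_norm_def by linarith
    qed
  qed
  then show ?thesis by (auto simp: convergent_def)
qed

section \<open>Counting the members of minimal subcovers\<close>

lemma min_subcover_le_card:
  assumes "V \<subseteq> U" "finite V" "\<Union>V = topspace X"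
  shows "min_subcover X U \<le> card V"
  unfolding min_subcover_def by (rule Least_le) (use assms in blast)

text \<open>\<open>LEAST\<close> is meaningful only if some finite subcover exists. A finite
  \<open>U\<close> is one itself, which is why finite covers stand in for compactness.\<close>

lemma min_subcover_attained:
  assumes "finite U" "\<Union>U = topspace X"
  obtains V where "V \<subseteq> U" "finite V" "card V = min_subcover X U" "\<Union>V = topspace X"
proof -
  have "\<exists>k. \<exists>V\<subseteq>U. finite V \<and> card V = k \<and> \<Union>V = topspace X"
    using assms by blast
  from LeastI_ex[OF this] show ?thesis
    unfolding min_subcover_def[symmetric] using that by blast
qed

text \<open>Pigeonhole: choosing for each point a member of a minimal subcover that contains it is
  injective, since no member holds two of the points.\<close>

lemma min_subcover_ge_separated:
  assumes U: "finite U" "\<Union>U = topspace X"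
    and p: "p ` I \<subseteq> topspace X"
    and sep: "\<And>S i j. S \<in> U \<Longrightarrow> i \<in> I \<Longrightarrow> j \<in> I \<Longrightarrow> p i \<in> S \<Longrightarrow> p j \<in> S \<Longrightarrow> i = j"
  shows "card I \<le> min_subcover X U"
proof -
  obtain V where V: "V \<subseteq> U" "finite V" "card V = min_subcover X U" "\<Union>V = topspace X"
    using min_subcover_attained[OF U] .
  have "\<forall>i\<in>I. \<exists>S\<in>V. p i \<in> S" using p V(4) by blast
  then obtain s where s: "\<And>i. i \<in> I \<Longrightarrow> s i \<in> V \<and> p i \<in> s i" by metis
  have "inj_on s I"
  proof (rule inj_onI)
    fix i j assume "i \<in> I" "j \<in> I" "s i = s j"
    with s[of i] s[of j] show "i = j" using V(1) sep[of "s i" i j] by auto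
  qed
  then have "card I \<le> card V" using s V(2) by (intro card_inj_on_le[of s]) auto
  with V(3) show ?thesis by simp
qed

lemma funpow_mem: "f \<in> A \<rightarrow> A \<Longrightarrow> x \<in> A \<Longrightarrow> (f ^^ n) x \<in> A"
  by (induction n) auto

lemma finite_cover_join:
  assumes "finite U"
  shows "finite (cover_join X f U n)"
proof -
  have "cover_join X f U n \<subseteq>
      (\<lambda>g. topspace X \<inter> (\<Inter>i<n. (f ^^ i) -` g i)) ` ({..<n} \<rightarrow>\<^sub>E U)"
  proof
    fix S assume "S \<in> cover_join X f U n"
    then obtain g where g: "\<forall>i<n. g i \<in> U" "S = topspace X \<inter> (\<Inter>i<n. (f ^^ i) -` g i)"
      by (auto simp: cover_join_def)
    show "S \<in> (\<lambda>g. topspace X \<inter> (\<Inter>i<n. (f ^^ i) -` g i)) ` ({..<n} \<rightarrow>\<^sub>E U)"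
      \<comment> \<open>Only the values of \<open>g\<close> below \<open>n\<close> matter, and there
        are finitely many extensional functions on that range.\<close>
      by (rule image_eqI[of _ _ "restrict g {..<n}"]) (use g in auto)
  qed
  then show ?thesis by (rule finite_subset) (auto intro: finite_PiE assms)
qed

lemma Union_cover_join:
  assumes f: "f \<in> topspace X \<rightarrow> topspace X" and U: "\<Union>U = topspace X"
  shows "\<Union>(cover_join X f U n) = topspace X"
proof
  show "topspace X \<subseteq> \<Union>(cover_join X f U n)"
  proof
    fix x assume x: "x \<in> topspace X"
    then have "\<forall>i. \<exists>S\<in>U. (f ^^ i) x \<in> S" using funpow_mem[OF f x] U by blast
    then obtain g where "\<And>i. g i \<in> U \<and> (f ^^ i) x \<in> g i" by metis
    then show "x \<in> \<Union>(cover_join X f U n)" using x by (auto simp: cover_join_def)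
  qed
qed (auto simp: cover_join_def)

text \<open>Intersecting a minimal subcover for the first \<open>m\<close> steps with the preimages
  under \<open>f ^^ m\<close> of one for \<open>n\<close> steps gives a subcover for
  \<open>m + n\<close> steps. The logarithms of the counts are therefore subadditive.\<close>

lemma min_subcover_join_add:
  assumes f: "f \<in> topspace X \<rightarrow> topspace X" and U: "finite U" "\<Union>U = topspace X"
  shows "min_subcover X (cover_join X f U (m + n)) \<le>
    min_subcover X (cover_join X f U m) * min_subcover X (cover_join X f U n)"
proof -
  note join = finite_cover_join[OF U(1), of X f] Union_cover_join[OF f U(2)]
  obtain V where V: "V \<subseteq> cover_join X f U m" "finite V"
    "card V = min_subcover X (cover_join X f U m)" "\<Union>V = topspace X"
    using min_subcover_attained[OF join] .
  obtain W where W: "W \<subseteq> cover_join X f U n" "finite W"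
    "card W = min_subcover X (cover_join X f U n)" "\<Union>W = topspace X"
    using min_subcover_attained[OF join] .
  define Z where "Z = (\<lambda>(v, w). v \<inter> (f ^^ m) -` w) ` (V \<times> W)"
  have "Z \<subseteq> cover_join X f U (m + n)"
  proof
    fix z assume "z \<in> Z"
    then obtain v w where vw: "v \<in> V" "w \<in> W" "z = v \<inter> (f ^^ m) -` w"
      by (auto simp: Z_def)
    obtain g where g: "\<forall>i<m. g i \<in> U" "v = topspace X \<inter> (\<Inter>i<m. (f ^^ i) -` g i)"
      using vw(1) V(1) by (auto simp: cover_join_def)
    obtain h where h: "\<forall>i<n. h i \<in> U" "w = topspace X \<inter> (\<Inter>i<n. (f ^^ i) -` h i)"
      using vw(2) W(1) by (auto simp: cover_join_def)
    \<comment> \<open>The two itineraries are concatenated, the second one shifted by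
      \<open>m\<close>.\<close>
    define k where "k i = (if i < m then g i else h (i - m))" for i
    have "\<forall>i<m + n. k i \<in> U" using g(1) h(1) by (auto simp: k_def)
    moreover have "x \<in> z \<longleftrightarrow> x \<in> topspace X \<inter> (\<Inter>i<m + n. (f ^^ i) -` k i)" for x
    proof -
      have "(\<forall>i<m + n. (f ^^ i) x \<in> k i) \<longleftrightarrow>
          (\<forall>i<m. (f ^^ i) x \<in> g i) \<and> (\<forall>i<n. (f ^^ (i + m)) x \<in> h i)"
      proof (intro iffI conjI allI impI)
        fix i assume *: "\<forall>i<m + n. (f ^^ i) x \<in> k i"
        show "i < m \<Longrightarrow> (f ^^ i) x \<in> g i" using *[rule_format, of i] by (simp add: k_def)
        show "i < n \<Longrightarrow> (f ^^ (i + m)) x \<in> h i"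
          using *[rule_format, of "i + m"] by (simp add: k_def)
      next
        fix i assume *: "(\<forall>i<m. (f ^^ i) x \<in> g i) \<and> (\<forall>i<n. (f ^^ (i + m)) x \<in> h i)"
          and i: "i < m + n"
        show "(f ^^ i) x \<in> k i"
        proof (cases "i < m")
          case False
          then show ?thesis
            using i conjunct2[OF *, rule_format, of "i - m"] by (simp add: k_def)
        qed (use * in \<open>simp add: k_def\<close>)
      qed
      moreover have "x \<in> topspace X \<Longrightarrow> (f ^^ m) x \<in> topspace X" by (rule funpow_mem[OF f])
      ultimately show ?thesis
        unfolding vw(3) g(2) h(2) by (auto simp: funpow_add)
    qed
    ultimately show "z \<in> cover_join X f U (m + n)"
      unfolding cover_join_def by blast
  qed
  moreover have "finite Z" using V(2) W(2) by (simp add: Z_def)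
  moreover have "\<Union>Z = topspace X"
  proof
    show "\<Union>Z \<subseteq> topspace X" using V(4) by (auto simp: Z_def)
    show "topspace X \<subseteq> \<Union>Z"
    proof
      fix x assume x: "x \<in> topspace X"
      then obtain v where "v \<in> V" "x \<in> v" using V(4) by blast
      moreover obtain w where "w \<in> W" "(f ^^ m) x \<in> w" using W(4) funpow_mem[OF f x] by blast
      ultimately show "x \<in> \<Union>Z" by (force simp: Z_def)
    qed
  qed
  ultimately have "min_subcover X (cover_join X f U (m + n)) \<le> card Z"
    by (rule min_subcover_le_card)
  also have "\<dots> \<le> card (V \<times> W)" unfolding Z_def
    by (rule card_image_le) (use V(2) W(2) in auto)
  finally show ?thesis using V(3) W(3) by (simp add: card_cartesian_product)
qed

text \<open>By subadditivity the quotients converge, so a lower bound along infinitely many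
  \<open>n\<close> already bounds the limit.\<close>

lemma top_entropy_rel_ge:
  assumes f: "f \<in> topspace X \<rightarrow> topspace X" and U: "finite U" "\<Union>U = topspace X"
    and ne: "topspace X \<noteq> {}"
    and c: "\<exists>\<^sub>F n in sequentially. c * real n \<le> ln (real (min_subcover X (cover_join X f U n)))"
  shows "c \<le> top_entropy_rel X f U"
proof -
  define a where "a n = ln (real (min_subcover X (cover_join X f U n)))" for n
  \<comment> \<open>A nonempty space needs at least one member, so the logarithms below are of
    positive numbers and are nonnegative.\<close>
  have pos: "min_subcover X (cover_join X f U n) \<ge> 1" for n
  proof -
    obtain V where V: "V \<subseteq> cover_join X f U n" "finite V"
      "card V = min_subcover X (cover_join X f U n)" "\<Union>V = topspace X"
      using min_subcover_attained[OF finite_cover_join[OF U(1)] Union_cover_join[OF f U(2)]] .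
    then have "V \<noteq> {}" using ne by (metis Union_empty)
    then have "card V > 0" using V(2) by (simp add: card_gt_0_iff)
    then show ?thesis using V(3) by simp
  qed
  have "convergent (\<lambda>n. a n / real n)"
  proof (rule subadditive_quotient_convergent)
    fix m n
    have "a (m + n) \<le> ln (real (min_subcover X (cover_join X f U m) * min_subcover X (cover_join X f U n)))"
      unfolding a_def
      using pos[of "m + n"] min_subcover_join_add[OF f U, of m n]
      by (intro ln_mono) (auto simp del: of_nat_mult)
    also have "\<dots> = a m + a n"
      unfolding a_def of_nat_mult using pos[of m] pos[of n] by (subst ln_mult) auto
    finally show "a (m + n) \<le> a m + a n" .
    show "0 \<le> a n" using pos[of n] by (simp add: a_def)
  qed
  then have lim: "(\<lambda>n. a n / real n) \<longlonglongrightarrow> top_entropy_rel X f U"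
    unfolding top_entropy_rel_def a_def by (simp add: convergent_LIMSEQ_iff)
  show ?thesis
  proof (rule ccontr)
    assume "\<not> ?thesis"
    then have "\<forall>\<^sub>F n in sequentially. a n / real n < c"
      using order_tendstoD(2)[OF lim] by auto
    then have "\<forall>\<^sub>F n in sequentially. \<not> c * real n \<le> a n"
      using eventually_gt_at_top[of 0] by eventually_elim (simp add: field_simps)
    then show False using c by (simp add: frequently_def a_def)
  qed
qed

section \<open>Riesz product couplings\<close>

lemma (in pair_sigma_finite) integral_product_functions:
  fixes f g :: "_ \<Rightarrow> real"
  assumes f: "integrable M1 f" and g: "integrable M2 g"
  shows integrable_product_functions: "integrable (M1 \<Otimes>\<^sub>M M2) (\<lambda>(x, y). f x * g y)"
    and "(\<integral>(x, y). f x * g y \<partial>(M1 \<Otimes>\<^sub>M M2)) = (\<integral>x. f x \<partial>M1) * (\<integral>y. g y \<partial>M2)"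
proof -
  note [measurable] = borel_measurable_integrable[OF f] borel_measurable_integrable[OF g]
  show int: "integrable (M1 \<Otimes>\<^sub>M M2) (\<lambda>(x, y). f x * g y)"
  proof (rule Fubini_integrable)
    show "integrable M1 (\<lambda>x. \<integral>y. norm (case (x, y) of (x, y) \<Rightarrow> f x * g y) \<partial>M2)"
      using f by (simp add: abs_mult)
    show "AE x in M1. integrable M2 (\<lambda>y. case (x, y) of (x, y) \<Rightarrow> f x * g y)"
      using g by simp
  qed measurable
  show "(\<integral>(x, y). f x * g y \<partial>(M1 \<Otimes>\<^sub>M M2)) = (\<integral>x. f x \<partial>M1) * (\<integral>y. g y \<partial>M2)"
    by (subst integral_fst[OF int, symmetric]) simp
qed

lemma sum_Pow_insert:
  assumes "finite A" "a \<notin> A"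
  shows "(\<Sum>S\<in>Pow (insert a A). f S) = (\<Sum>S\<in>Pow A. f S) + (\<Sum>S\<in>Pow A. f (insert a S))"
proof -
  have "inj_on (insert a) (Pow A)" using assms(2) by (auto intro!: inj_onI)
  moreover have "Pow A \<inter> insert a ` Pow A = {}" using assms(2) by auto
  ultimately show ?thesis using assms(1)
    by (simp add: Pow_insert sum.union_disjoint sum.reindex)
qed

text \<open>\<open>ennreal\<close> would cut off negative values, but for parameters in [0,1] and
  functions bounded by 1 no factor is negative, see \<open>riesz_kernel_nonneg\<close>.\<close>

definition riesz_coupling ::
  "'a measure \<Rightarrow> (nat \<Rightarrow> 'a \<Rightarrow> real) \<Rightarrow> (nat \<Rightarrow> real) \<Rightarrow> nat \<Rightarrow> ('a \<times> 'a) measure" where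
  "riesz_coupling M \<phi> t n =
     density (M \<Otimes>\<^sub>M M) (\<lambda>p. ennreal (\<Prod>i<n. 1 + t i * (\<phi> i (fst p) * \<phi> i (snd p))))"

text \<open>Every martingale difference sequence bounded by 1 satisfies \<open>orthogonal\<close>.\<close>

locale multiplicative_system = prob_space M for M :: "'a measure" +
  fixes \<phi> :: "nat \<Rightarrow> 'a \<Rightarrow> real"
  assumes measurable_\<phi> [measurable]: "\<And>i. \<phi> i \<in> borel_measurable M"
    and abs_\<phi>_le: "\<And>i x. x \<in> space M \<Longrightarrow> \<bar>\<phi> i x\<bar> \<le> 1"
    and orthogonal: "\<And>S. finite S \<Longrightarrow> S \<noteq> {} \<Longrightarrow> (\<integral>x. (\<Prod>i\<in>S. \<phi> i x) \<partial>M) = 0"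
begin

lemma integrable_indicator_prod:
  assumes [measurable]: "A \<in> sets M"
  shows "integrable M (\<lambda>x. indicator A x * (\<Prod>i\<in>S. \<phi> i x))"
proof (rule integrable_const_bound[where B = 1])
  show "AE x in M. norm (indicator A x * (\<Prod>i\<in>S. \<phi> i x)) \<le> 1"
  proof (rule AE_I2)
    fix x assume "x \<in> space M"
    then have "(\<Prod>i\<in>S. \<bar>\<phi> i x\<bar>) \<le> 1" by (intro prod_le_1) (auto simp: abs_\<phi>_le)
    then show "norm (indicator A x * (\<Prod>i\<in>S. \<phi> i x)) \<le> 1"
      by (auto simp: indicator_def abs_prod)
  qed
qed measurable

text \<open>The analogue of a Walsh coefficient of the indicator of \<open>A\<close>, with products
  of the \<phi>'s in the place of the Walsh functions.\<close>

definition coeff :: "'a set \<Rightarrow> nat set \<Rightarrow> real" where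
  "coeff A S = (\<integral>x. indicator A x * (\<Prod>i\<in>S. \<phi> i x) \<partial>M)"

lemma coeff_empty: "A \<in> sets M \<Longrightarrow> coeff A {} = measure M A"
  by (simp add: coeff_def)

lemma coeff_space:
  assumes "finite S" "S \<noteq> {}"
  shows "coeff (space M) S = 0"
proof -
  have "coeff (space M) S = (\<integral>x. (\<Prod>i\<in>S. \<phi> i x) \<partial>M)"
    unfolding coeff_def by (rule Bochner_Integration.integral_cong) auto
  then show ?thesis using orthogonal[OF assms] by simp
qed

lemma riesz_kernel_nonneg:
  assumes t: "\<And>i. 0 \<le> t i" "\<And>i. t i \<le> 1" and x: "x \<in> space M" "y \<in> space M"
  shows "0 \<le> (\<Prod>i<n. 1 + t i * (\<phi> i x * \<phi> i y))"
proof (rule prod_nonneg)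
  fix i
  have "\<bar>t i * (\<phi> i x * \<phi> i y)\<bar> \<le> 1"
    unfolding abs_mult using t[of i] abs_\<phi>_le x by (intro mult_le_one) auto
  then show "0 \<le> 1 + t i * (\<phi> i x * \<phi> i y)" by linarith
qed

text \<open>Expanding the Riesz product over the subsets \<open>S\<close> of the index range yields
  terms that split into a function of \<open>x\<close> times a function of \<open>y\<close>. Fubini
  turns each of them into a product of two coefficients.\<close>

lemma measure_riesz_coupling:
  assumes t: "\<And>i. 0 \<le> t i" "\<And>i. t i \<le> 1" and [measurable]: "A \<in> sets M" "B \<in> sets M"
  shows "measure (riesz_coupling M \<phi> t n) (A \<times> B) =
    (\<Sum>S\<in>Pow {..<n}. (\<Prod>i\<in>S. t i) * (coeff A S * coeff B S))"
proof -
  interpret pair_prob_space M M ..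
  define K where "K p = (\<Prod>i<n. 1 + t i * (\<phi> i (fst p) * \<phi> i (snd p)))" for p
  have [measurable]: "K \<in> borel_measurable (M \<Otimes>\<^sub>M M)" unfolding K_def by measurable
  have nn: "AE p in M \<Otimes>\<^sub>M M. 0 \<le> K p"
    using riesz_kernel_nonneg[OF t] by (intro AE_I2) (auto simp: K_def space_pair_measure)
  have "measure (riesz_coupling M \<phi> t n) (A \<times> B) = (\<integral>p. indicator (A \<times> B) p \<partial>riesz_coupling M \<phi> t n)"
  proof -
    have "A \<times> B \<subseteq> space M \<times> space M" using assms(3,4) sets.sets_into_space by blast
    then show ?thesis
      by (simp add: riesz_coupling_def space_pair_measure Int_absorb2)
  qed
  also have "\<dots> = (\<integral>p. K p * indicator (A \<times> B) p \<partial>(M \<Otimes>\<^sub>M M))"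
    unfolding riesz_coupling_def K_def[symmetric]
    by (subst integral_density) (use nn in auto)
  also have "\<dots> = (\<integral>p. (\<Sum>S\<in>Pow {..<n}. (\<Prod>i\<in>S. t i) * (case p of (x, y) \<Rightarrow>
      (indicator A x * (\<Prod>i\<in>S. \<phi> i x)) * (indicator B y * (\<Prod>i\<in>S. \<phi> i y)))) \<partial>(M \<Otimes>\<^sub>M M))"
  proof (rule Bochner_Integration.integral_cong)
    fix p :: "'a \<times> 'a"
    obtain x y where p: "p = (x, y)" by (cases p)
    have "K p = (\<Sum>S\<in>Pow {..<n}. (\<Prod>i\<in>S. t i) * ((\<Prod>i\<in>S. \<phi> i x) * (\<Prod>i\<in>S. \<phi> i y)))"
      unfolding K_def p fst_conv snd_conv
      by (subst add.commute, subst prod_add) (auto simp: prod.distrib)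
    then show "K p * indicator (A \<times> B) p = (\<Sum>S\<in>Pow {..<n}. (\<Prod>i\<in>S. t i) * (case p of (x, y) \<Rightarrow>
      (indicator A x * (\<Prod>i\<in>S. \<phi> i x)) * (indicator B y * (\<Prod>i\<in>S. \<phi> i y))))"
      by (simp add: p indicator_times sum_distrib_left sum_distrib_right mult_ac)
  qed simp
  also have "\<dots> = (\<Sum>S\<in>Pow {..<n}. (\<Prod>i\<in>S. t i) * (coeff A S * coeff B S))"
  proof (subst Bochner_Integration.integral_sum)
    show "integrable (M \<Otimes>\<^sub>M M) (\<lambda>p. (\<Prod>i\<in>S. t i) * (case p of (x, y) \<Rightarrow>
      (indicator A x * (\<Prod>i\<in>S. \<phi> i x)) * (indicator B y * (\<Prod>i\<in>S. \<phi> i y))))" for S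
      by (intro integrable_mult_right integrable_product_functions integrable_indicator_prod assms(3,4))
    show "(\<Sum>S\<in>Pow {..<n}. (\<integral>p. (\<Prod>i\<in>S. t i) * (case p of (x, y) \<Rightarrow>
      (indicator A x * (\<Prod>i\<in>S. \<phi> i x)) * (indicator B y * (\<Prod>i\<in>S. \<phi> i y))) \<partial>(M \<Otimes>\<^sub>M M))) =
      (\<Sum>S\<in>Pow {..<n}. (\<Prod>i\<in>S. t i) * (coeff A S * coeff B S))"
      unfolding coeff_def
      by (rule sum.cong)
        (simp_all only: integral_mult_right_zero integral_product_functions integrable_indicator_prod assms)
  qed
  finally show ?thesis .
qed

text \<open>By orthogonality all coefficients of the whole space vanish except the one of the empty
  set, so a single term of the expansion survives.\<close>

lemma measure_riesz_coupling_marginal: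
  assumes t: "\<And>i. 0 \<le> t i" "\<And>i. t i \<le> 1" and A: "A \<in> sets M"
  shows "measure (riesz_coupling M \<phi> t n) (A \<times> space M) = measure M A"
    and "measure (riesz_coupling M \<phi> t n) (space M \<times> A) = measure M A"
proof -
  have *: "(\<Sum>S\<in>Pow {..<n}. (\<Prod>i\<in>S. t i) * (coeff A S * coeff (space M) S)) = measure M A"
  proof -
    have "(\<Sum>S\<in>Pow {..<n}. (\<Prod>i\<in>S. t i) * (coeff A S * coeff (space M) S)) =
        (\<Sum>S\<in>{{}}. (\<Prod>i\<in>S. t i) * (coeff A S * coeff (space M) S))"
      using coeff_space by (intro sum.mono_neutral_right) (auto dest: finite_subset)
    then show ?thesis using A by (simp add: coeff_empty prob_space)
  qed
  show "measure (riesz_coupling M \<phi> t n) (A \<times> space M) = measure M A"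
    using measure_riesz_coupling[OF t A sets.top, where n = n] * by simp
  show "measure (riesz_coupling M \<phi> t n) (space M \<times> A) = measure M A"
    using measure_riesz_coupling[OF t sets.top A, where n = n] * by (simp add: mult.commute)
qed

lemma riesz_coupling_in_couplings2:
  assumes t: "\<And>i. 0 \<le> t i" "\<And>i. t i \<le> 1"
  shows "riesz_coupling M \<phi> t n \<in> couplings2 M"
proof -
  let ?\<rho> = "riesz_coupling M \<phi> t n"
  have sets [measurable_cong]: "sets ?\<rho> = sets (M \<Otimes>\<^sub>M M)" by (simp add: riesz_coupling_def)
  have space: "space ?\<rho> = space M \<times> space M" by (simp add: riesz_coupling_def space_pair_measure)
  have "measure ?\<rho> (space ?\<rho>) = 1"
    using measure_riesz_coupling_marginal[OF t sets.top] by (simp add: space prob_space)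
  \<comment> \<open>\<open>measure\<close> sends infinite mass to 0, so the value 1 excludes
    it.\<close>
  then have "emeasure ?\<rho> (space ?\<rho>) = 1"
    by (metis emeasure_eq_ennreal_measure ennreal_1 measure_zero_top zero_neq_one)
  then interpret R: prob_space ?\<rho> by (rule prob_spaceI)
  have "distr ?\<rho> M fst = M"
  proof (rule measure_eqI)
    fix A assume "A \<in> sets (distr ?\<rho> M fst)"
    then have A: "A \<in> sets M" by simp
    have "fst -` A \<inter> space ?\<rho> = A \<times> space M"
      using sets.sets_into_space[OF A] by (auto simp: space)
    moreover have "fst \<in> measurable ?\<rho> M" by measurable
    ultimately show "emeasure (distr ?\<rho> M fst) A = emeasure M A"
      using A measure_riesz_coupling_marginal[OF t A]
      by (simp add: emeasure_distr R.emeasure_eq_measure emeasure_eq_measure)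
  qed simp
  moreover have "distr ?\<rho> M snd = M"
  proof (rule measure_eqI)
    fix A assume "A \<in> sets (distr ?\<rho> M snd)"
    then have A: "A \<in> sets M" by simp
    have "snd -` A \<inter> space ?\<rho> = space M \<times> A"
      using sets.sets_into_space[OF A] by (auto simp: space)
    moreover have "snd \<in> measurable ?\<rho> M" by measurable
    ultimately show "emeasure (distr ?\<rho> M snd) A = emeasure M A"
      using A measure_riesz_coupling_marginal[OF t A]
      by (simp add: emeasure_distr R.emeasure_eq_measure emeasure_eq_measure)
  qed simp
  ultimately show ?thesis
    unfolding couplings2_def using sets R.prob_space_axioms by simp
qed

text \<open>The coordinates beyond \<open>i\<close> integrate out, and in what remains \<open>t i\<close> enters linearly; the
  other coefficients are squares, so that only the one of \<open>{i}\<close> is needed for the bound.\<close>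

lemma riesz_coupling_separated:
  assumes t: "\<And>i. 0 \<le> t i" "\<And>i. t i \<le> 1" and s: "\<And>i. 0 \<le> s i" "\<And>i. s i \<le> 1"
    and A: "A \<in> sets M" and i: "i < n"
    and vanish: "\<And>S j. finite S \<Longrightarrow> j \<in> S \<Longrightarrow> i < j \<Longrightarrow> coeff A S = 0"
    and agree: "\<And>j. j < i \<Longrightarrow> s j = t j" and le: "s i \<le> t i"
  shows "measure (riesz_coupling M \<phi> s n) (A \<times> A) + (t i - s i) * (coeff A {i})\<^sup>2
    \<le> measure (riesz_coupling M \<phi> t n) (A \<times> A)"
proof -
  define G where "G S = (coeff A S)\<^sup>2" for S
  define R where "R = (\<Sum>S\<in>Pow {..<i}. (\<Prod>j\<in>S. t j) * G (insert i S))"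
  have expand: "measure (riesz_coupling M \<phi> u n) (A \<times> A) =
      (\<Sum>S\<in>Pow {..<i}. (\<Prod>j\<in>S. t j) * G S) + u i * R"
    if u: "\<And>i. 0 \<le> u i" "\<And>i. u i \<le> 1" and agree: "\<And>j. j < i \<Longrightarrow> u j = t j" for u
  proof -
    have "measure (riesz_coupling M \<phi> u n) (A \<times> A) = (\<Sum>S\<in>Pow {..<n}. (\<Prod>j\<in>S. u j) * G S)"
      using measure_riesz_coupling[OF u A A, where n = n] by (simp add: G_def power2_eq_square)
    also have "\<dots> = (\<Sum>S\<in>Pow (insert i {..<i}). (\<Prod>j\<in>S. u j) * G S)"
    proof (rule sum.mono_neutral_right)
      show "Pow (insert i {..<i}) \<subseteq> Pow {..<n}" using i by auto
      show "\<forall>S\<in>Pow {..<n} - Pow (insert i {..<i}). (\<Prod>j\<in>S. u j) * G S = 0"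
      proof
        fix S assume S: "S \<in> Pow {..<n} - Pow (insert i {..<i})"
        then obtain j where "j \<in> S" "i < j" by fastforce
        moreover have "finite S" using S by (auto dest: finite_subset)
        ultimately show "(\<Prod>j\<in>S. u j) * G S = 0" using vanish by (simp add: G_def)
      qed
    qed simp
    also have "\<dots> = (\<Sum>S\<in>Pow {..<i}. (\<Prod>j\<in>S. u j) * G S) +
        (\<Sum>S\<in>Pow {..<i}. (\<Prod>j\<in>insert i S. u j) * G (insert i S))"
      by (rule sum_Pow_insert) auto
    also have "(\<Sum>S\<in>Pow {..<i}. (\<Prod>j\<in>S. u j) * G S) = (\<Sum>S\<in>Pow {..<i}. (\<Prod>j\<in>S. t j) * G S)"
      by (intro sum.cong refl arg_cong2[where f = "(*)"] prod.cong) (auto simp: agree)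
    also have "(\<Sum>S\<in>Pow {..<i}. (\<Prod>j\<in>insert i S. u j) * G (insert i S)) = u i * R"
      unfolding R_def sum_distrib_left
    proof (rule sum.cong)
      fix S assume S: "S \<in> Pow {..<i}"
      then have "finite S" "i \<notin> S" by (auto dest: finite_subset)
      moreover have "(\<Prod>j\<in>S. u j) = (\<Prod>j\<in>S. t j)" using S by (intro prod.cong) (auto simp: agree)
      ultimately show "(\<Prod>j\<in>insert i S. u j) * G (insert i S) = u i * ((\<Prod>j\<in>S. t j) * G (insert i S))"
        by simp
    qed simp
    finally show ?thesis .
  qed
  have "G {i} \<le> R"
    using member_le_sum[of "{}" "Pow {..<i}" "\<lambda>S. (\<Prod>j\<in>S. t j) * G (insert i S)"] t
    by (simp add: R_def G_def prod_nonneg)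
  then have "(t i - s i) * G {i} \<le> (t i - s i) * R" using le by (intro mult_left_mono) auto
  then show ?thesis
    using expand[OF t] expand[OF s agree] by (simp add: G_def algebra_simps)
qed

end

section \<open>Innovations of a finite partition\<close>

text \<open>Bounds the entropy of an outcome of probability \<open>r\<close> by its variance
  \<open>r * (1 - r)\<close>, at the price of a small error \<alpha>: where the variance is small,
  little entropy is produced.\<close>

lemma neg_mult_ln_le:
  fixes r \<alpha> :: real
  assumes r: "0 < r" "r \<le> 1" and \<alpha>: "0 < \<alpha>"
  shows "- (r * ln r) \<le> \<alpha> + r * (1 - r) / \<alpha>"
proof -
  \<comment> \<open>The bound \<open>ln x \<le> x - 1\<close> used at \<open>1 / r\<close> would
    give \<open>1 - r\<close>, which does not vanish at 0. Used at \<open>1 / s\<close> it gives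
    \<open>2 * (s * (1 - s))\<close>, which vanishes at both ends.\<close>
  define s where "s = sqrt r"
  have s: "0 < s" "s \<le> 1" "r = s\<^sup>2" using r by (auto simp: s_def)
  have "ln (1 / s) \<le> 1 / s - 1" using s by (intro ln_le_minus_one) auto
  then have "- ln s \<le> 1 / s - 1" using s by (simp add: ln_div)
  then have "s\<^sup>2 * (2 * (- ln s)) \<le> s\<^sup>2 * (2 * (1 / s - 1))" by (intro mult_left_mono) auto
  also have "\<dots> = 2 * (s * (1 - s))" using s by (simp add: field_simps power2_eq_square)
  \<comment> \<open>The arithmetic-geometric mean inequality with weight \<alpha>.\<close>
  also have "\<dots> \<le> \<alpha> + (s * (1 - s))\<^sup>2 / \<alpha>"
  proof -
    have "0 \<le> (\<alpha> - s * (1 - s))\<^sup>2 / \<alpha>" using \<alpha> by simp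
    also have "\<dots> = \<alpha> - 2 * (s * (1 - s)) + (s * (1 - s))\<^sup>2 / \<alpha>"
      using \<alpha> by (simp add: power2_eq_square field_simps)
    finally show ?thesis by simp
  qed
  also have "(s * (1 - s))\<^sup>2 \<le> s\<^sup>2 * (1 - s\<^sup>2)"
  proof -
    have "(1 - s) * (1 - s) \<le> (1 - s) * (1 + s)" using s by (intro mult_left_mono) auto
    then have "(1 - s)\<^sup>2 \<le> 1 - s\<^sup>2" by (simp add: power2_eq_square algebra_simps)
    then show ?thesis unfolding power_mult_distrib by (intro mult_left_mono) auto
  qed
  finally show ?thesis
    using s \<alpha> by (simp add: s(3) ln_realpow divide_right_mono)
qed

locale partition_process = prob_space M for M :: "'a measure" +
  fixes T :: "'a \<Rightarrow> 'a" and P :: "'a set set"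
  assumes measurable_T [measurable]: "T \<in> measurable M M"
    and partition: "finite_meas_partition M P"
begin

section \<open>Cells of the iterated partitions\<close>

lemma finite_P: "finite P" and P_sets: "B \<in> P \<Longrightarrow> B \<in> sets M"
  and P_disjoint: "B \<in> P \<Longrightarrow> B' \<in> P \<Longrightarrow> x \<in> B \<Longrightarrow> x \<in> B' \<Longrightarrow> B = B'"
  and Union_P: "\<Union>P = space M"
  using partition by (auto simp: finite_meas_partition_def disjoint_def)

lemma measurable_funpow [measurable]: "T ^^ n \<in> measurable M M"
  by (induction n) (auto simp: id_def[symmetric])

definition event :: "'a set \<Rightarrow> nat \<Rightarrow> 'a set" where
  "event B n = (T ^^ n) -` B \<inter> space M"

lemma event_sets [measurable]: "B \<in> sets M \<Longrightarrow> event B n \<in> sets M"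
  unfolding event_def by measurable

abbreviation cells :: "nat \<Rightarrow> 'a set set" where
  "cells \<equiv> part_join M T P"

lemma cells_0: "cells 0 = {space M}"
  by (simp add: part_join_def)

text \<open>\<open>part_join\<close> builds a cell from a whole name \<open>g\<close>. Splitting off
  the last letter allows inductions on the length.\<close>

lemma cells_Suc: "cells (Suc n) = (\<lambda>(C, B). C \<inter> event B n) ` (cells n \<times> P)"
proof (intro subset_antisym subsetI)
  fix A assume "A \<in> cells (Suc n)"
  then obtain g where g: "\<forall>i<Suc n. g i \<in> P" "A = space M \<inter> (\<Inter>i<Suc n. (T ^^ i) -` g i)"
    by (auto simp: part_join_def)
  have "space M \<inter> (\<Inter>i<n. (T ^^ i) -` g i) \<in> cells n"
    using g(1) unfolding part_join_def by auto
  moreover have "g n \<in> P" using g(1) by simp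
  moreover have "A = (\<lambda>(C, B). C \<inter> event B n) (space M \<inter> (\<Inter>i<n. (T ^^ i) -` g i), g n)"
    unfolding g(2) event_def by (auto simp: less_Suc_eq)
  ultimately show "A \<in> (\<lambda>(C, B). C \<inter> event B n) ` (cells n \<times> P)" by blast
next
  fix A assume "A \<in> (\<lambda>(C, B). C \<inter> event B n) ` (cells n \<times> P)"
  then obtain g B where g: "\<forall>i<n. g i \<in> P" "B \<in> P"
    "A = space M \<inter> (\<Inter>i<n. (T ^^ i) -` g i) \<inter> event B n"
    by (auto simp: part_join_def)
  have "A = space M \<inter> (\<Inter>i<Suc n. (T ^^ i) -` (g(n := B)) i)"
    unfolding g(3) event_def by (auto simp: less_Suc_eq split: if_splits)
  moreover have "\<forall>i<Suc n. (g(n := B)) i \<in> P" using g by (auto simp: less_Suc_eq)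
  ultimately show "A \<in> cells (Suc n)" unfolding part_join_def by blast
qed

lemma finite_cells: "finite (cells n)"
  by (induction n) (auto simp: cells_0 cells_Suc finite_P)

lemma cells_sets: "C \<in> cells n \<Longrightarrow> C \<in> sets M"
  by (induction n arbitrary: C) (auto simp: cells_0 cells_Suc P_sets event_sets)

lemma event_disjoint: "B \<in> P \<Longrightarrow> B' \<in> P \<Longrightarrow> x \<in> event B n \<Longrightarrow> x \<in> event B' n \<Longrightarrow> B = B'"
  using P_disjoint[of B B' "(T ^^ n) x"] by (simp add: event_def)

lemma cells_disjoint: "C \<in> cells n \<Longrightarrow> C' \<in> cells n \<Longrightarrow> x \<in> C \<Longrightarrow> x \<in> C' \<Longrightarrow> C = C'"
proof (induction n arbitrary: C C')
  case (Suc n)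
  then obtain D B D' B' where "D \<in> cells n" "B \<in> P" "C = D \<inter> event B n"
    "D' \<in> cells n" "B' \<in> P" "C' = D' \<inter> event B' n"
    by (auto simp: cells_Suc)
  with Suc show ?case using event_disjoint[of B B' x n] by auto
qed (auto simp: cells_0)

lemma event_cover: "x \<in> space M \<Longrightarrow> \<exists>B\<in>P. x \<in> event B n"
  using measurable_space[OF measurable_funpow, of x n] Union_P by (auto simp: event_def)

lemma Union_cells: "\<Union>(cells n) = space M"
proof (induction n)
  case (Suc n)
  have "\<Union>(cells (Suc n)) = (\<Union>C\<in>cells n. \<Union>B\<in>P. C \<inter> event B n)"
    by (auto simp: cells_Suc)
  also have "\<dots> = \<Union>(cells n)" 
  proof -
    have "C = (\<Union>B\<in>P. C \<inter> event B n)" if "C \<in> cells n" for C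
      using event_cover[of _ n] sets.sets_into_space[OF cells_sets[OF that]] by auto
    then show ?thesis by simp
  qed
  finally show ?case using Suc by simp
qed (simp add: cells_0)

lemma obtain_cell:
  assumes "x \<in> space M" obtains C where "C \<in> cells n" "x \<in> C"
  using assms Union_cells[of n] by blast

lemma sum_cells_indicator:
  assumes "C \<in> cells n" "x \<in> C"
  shows "(\<Sum>D\<in>cells n. indicator D x * f D) = (f C :: real)"
proof -
  have "(\<Sum>D\<in>cells n. indicator D x * f D) = (\<Sum>D\<in>{C}. indicator D x * f D)"
    using assms cells_disjoint[OF assms(1)] finite_cells
    by (intro sum.mono_neutral_right) (auto simp: indicator_def)
  then show ?thesis using assms by simp
qed

lemma measure_eq_sum_cells:
  assumes A: "A \<in> sets M"
  shows "measure M A = (\<Sum>C\<in>cells n. measure M (C \<inter> A))"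
proof -
  have "A = (\<Union>C\<in>cells n. C \<inter> A)"
    using Union_cells[of n] sets.sets_into_space[OF A] by auto
  also have "measure M \<dots> = (\<Sum>C\<in>cells n. measure M (C \<inter> A))"
    using cells_disjoint A cells_sets
    by (intro finite_measure_finite_Union) (auto simp: disjoint_family_on_def finite_cells)
  finally show ?thesis .
qed

lemma measure_eq_sum_events:
  assumes A: "A \<in> sets M"
  shows "measure M A = (\<Sum>B\<in>P. measure M (A \<inter> event B n))"
proof -
  have "A = (\<Union>B\<in>P. A \<inter> event B n)"
    using event_cover sets.sets_into_space[OF A] by auto
  also have "measure M \<dots> = (\<Sum>B\<in>P. measure M (A \<inter> event B n))"
    using event_disjoint A P_sets
    by (intro finite_measure_finite_Union) (auto simp: disjoint_family_on_def finite_P event_sets)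
  finally show ?thesis .
qed

section \<open>Conditional probabilities given the past, and innovations\<close>

definition cond_prob :: "'a set \<Rightarrow> nat \<Rightarrow> 'a set \<Rightarrow> real" where
  "cond_prob B n C = measure M (C \<inter> event B n) / measure M C"

text \<open>On a null cell the quotient is 0 by the convention for division; both sides then vanish,
  so null cells need no separate treatment later.\<close>

lemma cond_prob_mult:
  assumes "C \<in> cells n"
  shows "cond_prob B n C * measure M C = measure M (C \<inter> event B n)"
proof (cases "measure M C = 0")
  case True
  then have "measure M (C \<inter> event B n) \<le> 0"
    using finite_measure_mono[of "C \<inter> event B n" C] cells_sets[OF assms] by simp
  then show ?thesis using True by (simp add: measure_le_0_iff)
qed (simp add: cond_prob_def)

lemma cond_prob_bounds:
  assumes "C \<in> cells n"
  shows "0 \<le> cond_prob B n C" "cond_prob B n C \<le> 1"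
proof -
  have "measure M (C \<inter> event B n) \<le> measure M C"
    using cells_sets[OF assms] by (intro finite_measure_mono) auto
  then show "cond_prob B n C \<le> 1"
    by (cases "measure M C = 0") (auto simp: cond_prob_def divide_le_eq_1 zero_less_measure_iff)
qed (simp add: cond_prob_def)

definition innovation :: "'a set \<Rightarrow> nat \<Rightarrow> 'a \<Rightarrow> real" where
  "innovation B n x = indicator (event B n) x - (\<Sum>C\<in>cells n. indicator C x * cond_prob B n C)"

lemma innovation_cell:
  assumes "C \<in> cells n" "x \<in> C"
  shows "innovation B n x = indicator (event B n) x - cond_prob B n C"
  unfolding innovation_def by (simp add: sum_cells_indicator[OF assms])

lemma abs_innovation_le:
  assumes "x \<in> space M"
  shows "\<bar>innovation B n x\<bar> \<le> 1"
proof -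
  obtain C where C: "C \<in> cells n" "x \<in> C" using obtain_cell[OF assms] .
  then show ?thesis
    using cond_prob_bounds[OF C(1), of B] by (auto simp: innovation_cell[OF C] indicator_def)
qed

lemma measurable_innovation:
  assumes B: "B \<in> P"
  shows "innovation B n \<in> borel_measurable M"
proof -
  note [measurable] = event_sets[OF P_sets[OF B]] cells_sets
  show ?thesis unfolding innovation_def by measurable
qed

text \<open>Measurability with respect to the finite algebra generated by \<open>cells n\<close>,
  put pointwise.\<close>

definition cell_const :: "nat \<Rightarrow> ('a \<Rightarrow> real) \<Rightarrow> bool" where
  "cell_const n g \<longleftrightarrow> (\<forall>C\<in>cells n. \<forall>x\<in>C. \<forall>y\<in>C. g x = g y)"

lemma cell_const_Suc: "cell_const n g \<Longrightarrow> cell_const (Suc n) g"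
  by (auto simp: cell_const_def cells_Suc)

lemma cell_const_mono: "m \<le> n \<Longrightarrow> cell_const m g \<Longrightarrow> cell_const n g"
  by (induction n rule: dec_induct) (auto intro: cell_const_Suc)

text \<open>Names of length \<open>Suc n\<close> record the times 0 to \<open>n\<close>, and their
  last letter decides the event.\<close>

lemma cell_const_event:
  assumes "B \<in> P"
  shows "cell_const (Suc n) (indicator (event B n))"
  unfolding cell_const_def
proof (intro ballI)
  fix C x y assume C: "C \<in> cells (Suc n)" "x \<in> C" "y \<in> C"
  then obtain B' where "B' \<in> P" "x \<in> event B' n" "y \<in> event B' n" by (auto simp: cells_Suc)
  then have "x \<in> event B n \<longleftrightarrow> y \<in> event B n"
    using event_disjoint[OF assms, of B' x n] event_disjoint[OF assms, of B' y n] by blast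
  then show "indicator (event B n) x = (indicator (event B n) y :: real)" by (simp add: indicator_def)
qed

lemma cell_const_innovation:
  assumes "B \<in> P"
  shows "cell_const (Suc n) (innovation B n)"
  unfolding cell_const_def
proof (intro ballI)
  fix C x y assume C: "C \<in> cells (Suc n)" "x \<in> C" "y \<in> C"
  then obtain D where D: "D \<in> cells n" "x \<in> D" "y \<in> D" by (auto simp: cells_Suc)
  have "(indicator (event B n) x :: real) = indicator (event B n) y"
    using cell_const_event[OF assms, of n] C unfolding cell_const_def by blast
  then show "innovation B n x = innovation B n y"
    using D by (simp add: innovation_cell[OF D(1)])
qed

lemma cell_const_mult: "cell_const n f \<Longrightarrow> cell_const n g \<Longrightarrow> cell_const n (\<lambda>x. f x * g x)"
  unfolding cell_const_def by (intro ballI arg_cong2[where f = "(*)"]) blast+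

lemma cell_const_prod: "(\<And>i. i \<in> S \<Longrightarrow> cell_const n (f i)) \<Longrightarrow> cell_const n (\<lambda>x. \<Prod>i\<in>S. f i x)"
  unfolding cell_const_def by (intro ballI prod.cong refl) blast

text \<open>The martingale difference property. On each cell \<open>g\<close> is a constant, and the
  innovation integrates to zero there by the choice of \<open>cond_prob\<close>.\<close>

lemma integral_cell_const_innovation:
  assumes B: "B \<in> P" and g: "cell_const n g"
  shows "(\<integral>x. g x * innovation B n x \<partial>M) = 0"
proof -
  note [measurable] = event_sets[OF P_sets[OF B]] cells_sets
  \<comment> \<open>An empty cell receives an arbitrary value, but its term in the sum is
    zero.\<close>
  define c where "c C = g (SOME x. x \<in> C)" for C
  have "(\<integral>x. g x * innovation B n x \<partial>M) =
      (\<integral>x. (\<Sum>C\<in>cells n. c C * (indicator (C \<inter> event B n) x - cond_prob B n C * indicator C x)) \<partial>M)"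
  proof (rule Bochner_Integration.integral_cong)
    fix x assume "x \<in> space M"
    then obtain C where C: "C \<in> cells n" "x \<in> C" by (rule obtain_cell)
    have "g x = c C"
      using g C unfolding cell_const_def c_def by (metis someI)
    then have "g x * innovation B n x = c C * (indicator (event B n) x - cond_prob B n C)"
      by (simp add: innovation_cell[OF C])
    also have "\<dots> = (\<Sum>D\<in>cells n. indicator D x * (c D * (indicator (event B n) x - cond_prob B n D)))"
      by (rule sum_cells_indicator[OF C, symmetric])
    also have "\<dots> = (\<Sum>D\<in>cells n. c D * (indicator (D \<inter> event B n) x - cond_prob B n D * indicator D x))"
      by (rule sum.cong) (auto simp: indicator_def)
    finally show "g x * innovation B n x =
      (\<Sum>D\<in>cells n. c D * (indicator (D \<inter> event B n) x - cond_prob B n D * indicator D x))" .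
  qed simp
  also have "\<dots> = (\<Sum>C\<in>cells n. c C * (measure M (C \<inter> event B n) - cond_prob B n C * measure M C))"
  proof (subst Bochner_Integration.integral_sum)
    show "C \<in> cells n \<Longrightarrow> integrable M (\<lambda>x. c C * (indicator (C \<inter> event B n) x - cond_prob B n C * indicator C x))" for C
      by (intro integrable_mult_right Bochner_Integration.integrable_diff) (auto simp: emeasure_eq_measure)
    show "(\<Sum>C\<in>cells n. (\<integral>x. c C * (indicator (C \<inter> event B n) x - cond_prob B n C * indicator C x) \<partial>M)) =
      (\<Sum>C\<in>cells n. c C * (measure M (C \<inter> event B n) - cond_prob B n C * measure M C))"
    proof (rule sum.cong)
      fix C assume C: "C \<in> cells n"
      have "(\<integral>x. indicator (C \<inter> event B n) x - cond_prob B n C * indicator C x \<partial>M) =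
          measure M (C \<inter> event B n) - cond_prob B n C * measure M C"
        using cells_sets[OF C] sets.sets_into_space[OF cells_sets[OF C]]
        by (subst Bochner_Integration.integral_diff) (auto simp: emeasure_eq_measure Int_absorb2 le_infI1)
      then show "(\<integral>x. c C * (indicator (C \<inter> event B n) x - cond_prob B n C * indicator C x) \<partial>M) =
          c C * (measure M (C \<inter> event B n) - cond_prob B n C * measure M C)" by simp
    qed simp
  qed
  also have "\<dots> = 0" by (intro sum.neutral) (simp add: cond_prob_mult)
  finally show ?thesis .
qed

text \<open>The innovation with the largest index \<open>m\<close> in \<open>S\<close> integrates to
  zero against everything else: the other innovations and \<open>g\<close> are constant on the cells
  of length \<open>m\<close>. The factor \<open>g\<close> is 1 for orthogonality and an indicator
  for the vanishing of coefficients.\<close>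

lemma integral_innovation_prod:
  assumes B: "B \<in> P" and S: "finite S" "j \<in> S" "\<And>k. j \<le> k \<Longrightarrow> cell_const k g"
  shows "(\<integral>x. g x * (\<Prod>i\<in>S. innovation B i x) \<partial>M) = 0"
proof -
  define m where "m = Max S"
  have m: "m \<in> S" "\<And>i. i \<in> S \<Longrightarrow> i \<le> m"
    using S(1,2) by (auto simp: m_def intro!: Max_in)
  have "cell_const m (\<lambda>x. g x * (\<Prod>i\<in>S - {m}. innovation B i x))"
  proof (intro cell_const_mult cell_const_prod)
    fix i assume "i \<in> S - {m}"
    then have "Suc i \<le> m" using m(2)[of i] by auto
    then show "cell_const m (innovation B i)"
      by (rule cell_const_mono) (rule cell_const_innovation[OF B])
  qed (use S m in auto)
  from integral_cell_const_innovation[OF B this] show ?thesis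
    by (simp add: prod.remove[OF S(1) m(1)] mult_ac)
qed

lemma multiplicative_system_innovation:
  assumes B: "B \<in> P"
  shows "multiplicative_system M (innovation B)"
proof
  fix S :: "nat set" assume S: "finite S" "S \<noteq> {}"
  then obtain j where "j \<in> S" by blast
  then show "(\<integral>x. (\<Prod>i\<in>S. innovation B i x) \<partial>M) = 0"
    using integral_innovation_prod[OF B S(1), of j "\<lambda>_. 1"] by (simp add: cell_const_def)
qed (auto simp: measurable_innovation abs_innovation_le B)

text \<open>The event at time \<open>i\<close> is decided by the cells of length
  \<open>Suc i\<close>, hence by those of any length from \<open>j\<close> on.\<close>

lemma coeff_event_eq_0:
  assumes B: "B \<in> P" and S: "finite S" "j \<in> S" "i < j"
  shows "multiplicative_system.coeff M (innovation B) (event B i) S = 0"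
  unfolding multiplicative_system.coeff_def[OF multiplicative_system_innovation[OF B]]
  using S(3) by (intro integral_innovation_prod[OF B S(1,2)])
    (auto intro: cell_const_mono[OF _ cell_const_event[OF B]])

section \<open>Variance of the innovations and growth of entropy\<close>

definition innovation_var :: "'a set \<Rightarrow> nat \<Rightarrow> real" where
  "innovation_var B n = (\<Sum>C\<in>cells n. measure M (C \<inter> event B n) * (1 - cond_prob B n C))"

text \<open>On the event the innovation is 1 minus the conditional probability \<open>p\<close> of
  the cell. Summing gives \<open>p * (1 - p)\<close> averaged over the cells, which is the second
  moment of the innovation.\<close>

lemma coeff_event_singleton:
  assumes B: "B \<in> P"
  shows "multiplicative_system.coeff M (innovation B) (event B n) {n} = innovation_var B n"
proof -
  note [measurable] = event_sets[OF P_sets[OF B]] cells_sets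
  have "multiplicative_system.coeff M (innovation B) (event B n) {n} =
      (\<integral>x. indicator (event B n) x * innovation B n x \<partial>M)"
    by (simp add: multiplicative_system.coeff_def[OF multiplicative_system_innovation[OF B]])
  also have "\<dots> = (\<integral>x. (\<Sum>C\<in>cells n. (1 - cond_prob B n C) * indicator (C \<inter> event B n) x) \<partial>M)"
  proof (rule Bochner_Integration.integral_cong)
    fix x assume "x \<in> space M"
    then obtain C where C: "C \<in> cells n" "x \<in> C" by (rule obtain_cell)
    have "indicator (event B n) x * innovation B n x = (1 - cond_prob B n C) * indicator (event B n) x"
      by (simp add: innovation_cell[OF C] indicator_def)
    also have "\<dots> = (\<Sum>D\<in>cells n. indicator D x * ((1 - cond_prob B n D) * indicator (event B n) x))"
      by (rule sum_cells_indicator[OF C, symmetric])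
    also have "\<dots> = (\<Sum>D\<in>cells n. (1 - cond_prob B n D) * indicator (D \<inter> event B n) x)"
      by (rule sum.cong) (auto simp: indicator_def)
    finally show "indicator (event B n) x * innovation B n x =
      (\<Sum>D\<in>cells n. (1 - cond_prob B n D) * indicator (D \<inter> event B n) x)" .
  qed simp
  also have "\<dots> = (\<Sum>C\<in>cells n. (1 - cond_prob B n C) * measure M (C \<inter> event B n))"
  proof (subst Bochner_Integration.integral_sum)
    show "C \<in> cells n \<Longrightarrow> integrable M (\<lambda>x. (1 - cond_prob B n C) * indicator (C \<inter> event B n) x)" for C
      by (intro integrable_mult_right) (auto simp: emeasure_eq_measure)
    show "(\<Sum>C\<in>cells n. (\<integral>x. (1 - cond_prob B n C) * indicator (C \<inter> event B n) x \<partial>M)) =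
      (\<Sum>C\<in>cells n. (1 - cond_prob B n C) * measure M (C \<inter> event B n))"
      using sets.sets_into_space[OF cells_sets] by (intro sum.cong) (auto simp: Int_absorb2 le_infI1)
  qed
  finally show ?thesis by (simp add: innovation_var_def mult.commute)
qed

lemma innovation_var_bounds:
  assumes B: "B \<in> P"
  shows "0 \<le> innovation_var B n" "innovation_var B n \<le> 1"
proof -
  show "0 \<le> innovation_var B n"
    unfolding innovation_var_def by (intro sum_nonneg mult_nonneg_nonneg) (auto simp: cond_prob_bounds)
  have "innovation_var B n \<le> (\<Sum>C\<in>cells n. measure M (C \<inter> event B n))"
    unfolding innovation_var_def by (intro sum_mono mult_right_le_one_le) (auto simp: cond_prob_bounds)
  also have "\<dots> \<le> 1"
    using measure_eq_sum_cells[of "event B n" n] prob_le_1[of "event B n"] P_sets[OF B] by (simp add: event_sets)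
  finally show "innovation_var B n \<le> 1" .
qed

text \<open>The chain rule: the increase of entropy is the conditional entropy of the new letter,
  and \<open>neg_mult_ln_le\<close> bounds it by variances, cell by cell.\<close>

lemma part_entropy_cells_Suc_le:
  assumes \<alpha>: "0 < \<alpha>"
  shows "part_entropy M (cells (Suc n)) \<le>
    part_entropy M (cells n) + (\<Sum>B\<in>P. \<alpha> + innovation_var B n / \<alpha>)"
proof -
  let ?m = "\<lambda>C B. measure M (C \<inter> event B n)"
  have eq: "part_entropy M (cells (Suc n)) = (\<Sum>C\<in>cells n. \<Sum>B\<in>P. - (?m C B * ln (?m C B)))"
  proof -
    have "(\<Sum>A\<in>cells (Suc n). measure M A * ln (measure M A)) =
        (\<Sum>p\<in>cells n \<times> P. (\<lambda>A. measure M A * ln (measure M A)) (case p of (C, B) \<Rightarrow> C \<inter> event B n))"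
      unfolding cells_Suc
    \<comment> \<open>Different pairs may give the same set only if it is empty, and its term is
      0.\<close>
    proof (subst sum.reindex_nontrivial)
      fix p p' assume p: "p \<in> cells n \<times> P" "p' \<in> cells n \<times> P" "p \<noteq> p'"
        "(case p of (C, B) \<Rightarrow> C \<inter> event B n) = (case p' of (C, B) \<Rightarrow> C \<inter> event B n)"
      have "(case p of (C, B) \<Rightarrow> C \<inter> event B n) = {}"
      proof (rule ccontr)
        assume "(case p of (C, B) \<Rightarrow> C \<inter> event B n) \<noteq> {}"
        then obtain x where "x \<in> (case p of (C, B) \<Rightarrow> C \<inter> event B n)"
          "x \<in> (case p' of (C, B) \<Rightarrow> C \<inter> event B n)" using p(4) by auto
        then have "p = p'"
          using p(1,2) cells_disjoint[of "fst p" n "fst p'" x] event_disjoint[of "snd p" "snd p'" x n]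
          by (auto simp: case_prod_beta prod_eq_iff)
        then show False using p(3) by simp
      qed
      then show "measure M (case p of (C, B) \<Rightarrow> C \<inter> event B n) *
          ln (measure M (case p of (C, B) \<Rightarrow> C \<inter> event B n)) = 0" by simp
    qed (auto simp: finite_cells finite_P)
    then show ?thesis
      by (simp add: part_entropy_def sum.cartesian_product sum_negf case_prod_beta)
  qed
  have step: "- (?m C B * ln (?m C B)) \<le>
      - (?m C B * ln (measure M C)) + (measure M C * \<alpha> + ?m C B * (1 - cond_prob B n C) / \<alpha>)"
    if C: "C \<in> cells n" for C B
  proof (cases "?m C B = 0")
    case False
    then have m: "0 < ?m C B" by (simp add: zero_less_measure_iff)
    moreover have "?m C B \<le> measure M C" using cells_sets[OF C] by (intro finite_measure_mono) auto
    ultimately have c: "0 < measure M C" by linarith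
    \<comment> \<open>The logarithm of \<open>r * measure M C\<close> splits into a part for the old
      cell and a part for the new letter; the latter is estimated after weighting with the measure
      of \<open>C\<close>.\<close>
    define r where "r = cond_prob B n C"
    have r: "0 < r" "r \<le> 1" "?m C B = r * measure M C"
      using m c cond_prob_bounds[OF C, of B] cond_prob_mult[OF C, of B]
      by (auto simp: r_def cond_prob_def)
    have "measure M C * - (r * ln r) \<le> measure M C * (\<alpha> + r * (1 - r) / \<alpha>)"
      using neg_mult_ln_le[OF r(1,2) \<alpha>] by (intro mult_left_mono) auto
    moreover have "ln (?m C B) = ln r + ln (measure M C)"
      unfolding r(3) using r(1) c by (simp add: ln_mult)
    ultimately show ?thesis
      unfolding r_def[symmetric] using r(3) by (simp add: algebra_simps)
  qed (use \<alpha> in simp)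
  have "part_entropy M (cells (Suc n)) \<le>
      (\<Sum>C\<in>cells n. \<Sum>B\<in>P. - (?m C B * ln (measure M C)) + (measure M C * \<alpha> + ?m C B * (1 - cond_prob B n C) / \<alpha>))"
    unfolding eq by (intro sum_mono step)
  also have "\<dots> = (\<Sum>C\<in>cells n. \<Sum>B\<in>P. - (?m C B * ln (measure M C))) +
      (\<Sum>B\<in>P. \<Sum>C\<in>cells n. measure M C * \<alpha> + ?m C B * (1 - cond_prob B n C) / \<alpha>)"
    unfolding sum.distrib by (subst (2 3) sum.swap) simp
  also have "(\<Sum>C\<in>cells n. \<Sum>B\<in>P. - (?m C B * ln (measure M C))) = part_entropy M (cells n)"
    unfolding part_entropy_def sum_negf sum_distrib_right[symmetric]
    by (intro arg_cong[where f = uminus] sum.cong refl arg_cong2[where f = "(*)"]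
        measure_eq_sum_events[symmetric] cells_sets)
  also have "(\<Sum>B\<in>P. \<Sum>C\<in>cells n. measure M C * \<alpha> + ?m C B * (1 - cond_prob B n C) / \<alpha>) =
      (\<Sum>B\<in>P. \<alpha> + innovation_var B n / \<alpha>)"
  proof -
    have "(\<Sum>C\<in>cells n. measure M C) = 1"
      using measure_eq_sum_cells[OF sets.top, of n] sets.sets_into_space[OF cells_sets, of _ n]
      by (simp add: prob_space Int_absorb2)
    then show ?thesis
      by (simp add: sum.distrib innovation_var_def flip: sum_distrib_right sum_divide_distrib)
  qed
  finally show ?thesis .
qed

lemma part_entropy_cells_le:
  assumes \<alpha>: "0 < \<alpha>"
  shows "part_entropy M (cells n) \<le> (\<Sum>B\<in>P. \<alpha> * real n + (\<Sum>i<n. innovation_var B i) / \<alpha>)"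
proof (induction n)
  case 0
  then show ?case by (simp add: part_entropy_def cells_0 prob_space)
next
  case (Suc n)
  have "part_entropy M (cells (Suc n)) \<le> (\<Sum>B\<in>P. \<alpha> * real n + (\<Sum>i<n. innovation_var B i) / \<alpha>) +
      (\<Sum>B\<in>P. \<alpha> + innovation_var B n / \<alpha>)"
    using part_entropy_cells_Suc_le[OF \<alpha>, of n] Suc by linarith
  also have "\<dots> = (\<Sum>B\<in>P. \<alpha> * real (Suc n) + (\<Sum>i<Suc n. innovation_var B i) / \<alpha>)"
    unfolding sum.distrib[symmetric]
    by (rule sum.cong) (simp_all add: distrib_left add_divide_distrib)
  finally show ?case .
qed

lemma part_entropy_cells_nonneg: "0 \<le> part_entropy M (cells n)"
proof -
  have "measure M C * ln (measure M C) \<le> 0" for C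
  proof (cases "measure M C = 0")
    case False
    then have "0 < measure M C" by (simp add: zero_less_measure_iff)
    then show ?thesis by (intro mult_nonneg_nonpos) (auto simp: ln_le_zero_iff)
  qed simp
  then show ?thesis unfolding part_entropy_def by (simp add: sum_nonpos)
qed

text \<open>If all accumulated variances were small, \<open>part_entropy_cells_le\<close> would make
  the entropy small. A large sum of terms bounded by 1 must have many terms that are not
  small.\<close>

lemma frequently_many_innovations:
  assumes h: "0 < ks_entropy_rel M T P"
  obtains B v where "B \<in> P" "0 < v"
    "\<exists>\<^sub>F n in sequentially. v * real n \<le> real (card {i. i < n \<and> v \<le> innovation_var B i})"
proof -
  \<comment> \<open>Quotients tending to 0 would force the \<open>lim\<close> to be 0. So they
    exceed some \<open>e\<close> infinitely often, and only this is used of the entropy.\<close>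
  have "\<not> (\<lambda>n. part_entropy M (cells n) / real n) \<longlonglongrightarrow> 0"
    using h limI[of "\<lambda>n. part_entropy M (cells n) / real n" 0] by (auto simp: ks_entropy_rel_def)
  then obtain e where e: "0 < e" "\<not> (\<forall>\<^sub>F n in sequentially. \<bar>part_entropy M (cells n) / real n\<bar> < e)"
    by (auto simp: tendsto_iff dist_real_def)
  have freq: "\<exists>\<^sub>F n in sequentially. e \<le> part_entropy M (cells n) / real n \<and> 0 < n"
  proof (rule frequently_eventually_frequently[OF _ eventually_gt_at_top])
    show "\<exists>\<^sub>F n in sequentially. e \<le> part_entropy M (cells n) / real n"
      using e(2) by (simp add: frequently_def not_le part_entropy_cells_nonneg)
  qed
  have "P \<noteq> {}" using Union_P not_empty by auto
  define p where "p = real (card P)"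
  have p: "0 < p" using \<open>P \<noteq> {}\<close> finite_P by (simp add: p_def card_gt_0_iff)
  \<comment> \<open>Chosen so that \<open>p\<close> summands
    \<open>\<alpha> * n + \<alpha>\<^sup>2 * n / \<alpha>\<close> add up to exactly
    \<open>e * n\<close>.\<close>
  define \<alpha> where "\<alpha> = e / (2 * p)"
  have \<alpha>: "0 < \<alpha>" using e p by (simp add: \<alpha>_def)
  have "\<exists>\<^sub>F n in sequentially. \<exists>B\<in>P. \<alpha>\<^sup>2 * real n \<le> (\<Sum>i<n. innovation_var B i)"
    using freq
  proof (rule frequently_elim1)
    fix n assume n: "e \<le> part_entropy M (cells n) / real n \<and> 0 < n"
    show "\<exists>B\<in>P. \<alpha>\<^sup>2 * real n \<le> (\<Sum>i<n. innovation_var B i)"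
    proof (rule ccontr)
      assume "\<not> ?thesis"
      then have lt: "(\<Sum>i<n. innovation_var B i) < \<alpha>\<^sup>2 * real n" if "B \<in> P" for B using that by force
      have "e * real n \<le> part_entropy M (cells n)" using conjunct1[OF n] conjunct2[OF n] by (simp add: pos_le_divide_eq)
      also have "\<dots> \<le> (\<Sum>B\<in>P. \<alpha> * real n + (\<Sum>i<n. innovation_var B i) / \<alpha>)"
        by (rule part_entropy_cells_le[OF \<alpha>])
      also have "\<dots> < (\<Sum>B\<in>P. \<alpha> * real n + \<alpha>\<^sup>2 * real n / \<alpha>)"
        using lt \<alpha> by (intro sum_strict_mono finite_P \<open>P \<noteq> {}\<close> add_strict_left_mono divide_strict_right_mono)
      also have "\<dots> = e * real n"
        using p \<alpha> by (simp add: power2_eq_square p_def[symmetric]) (simp add: \<alpha>_def)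
      finally show False by simp
    qed
  qed
  \<comment> \<open>The set \<open>B\<close> found so far depends on \<open>n\<close>; as
    \<open>P\<close> is finite, one set serves infinitely many \<open>n\<close>.\<close>
  from frequently_bex_finite[OF finite_P this]
  obtain B where B: "B \<in> P" "\<exists>\<^sub>F n in sequentially. \<alpha>\<^sup>2 * real n \<le> (\<Sum>i<n. innovation_var B i)"
    by blast
  \<comment> \<open>Variances below \<open>v\<close> contribute at most \<open>v * n\<close> to a
    sum of at least \<open>2 * v * n\<close>, and each of the others at most 1.\<close>
  define v where "v = \<alpha>\<^sup>2 / 2"
  have v: "0 < v" using \<alpha> by (simp add: v_def)
  have "\<exists>\<^sub>F n in sequentially. v * real n \<le> real (card {i. i < n \<and> v \<le> innovation_var B i})"
    using B(2)
  proof (rule frequently_elim1)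
    fix n assume n: "\<alpha>\<^sup>2 * real n \<le> (\<Sum>i<n. innovation_var B i)"
    have "(\<Sum>i<n. innovation_var B i) \<le> (\<Sum>i<n. v + (if v \<le> innovation_var B i then 1 else 0))"
      using innovation_var_bounds[OF B(1)] v by (intro sum_mono) (auto intro: add_increasing)
    also have "\<dots> = v * real n + real (card {i. i < n \<and> v \<le> innovation_var B i})"
      by (simp add: sum.distrib sum.If_cases Int_def)
    finally show "v * real n \<le> real (card {i. i < n \<and> v \<le> innovation_var B i})"
      using n by (simp add: v_def)
  qed
  with B(1) v show ?thesis by (rule that)
qed

end

section \<open>The lens\<close>

lemma topspace_couplings2_topology: "topspace (couplings2_topology M) = couplings2 M"
proof -
  \<comment> \<open>The underlying set of a generated topology is the union of the generators;
    taking \<open>UNIV\<close> for \<open>W\<close> makes the full set of couplings one of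
    them.\<close>
  have "{\<rho> \<in> couplings2 M. measure \<rho> (space M \<times> space M) \<in> UNIV} \<in>
      {{\<rho> \<in> couplings2 M. measure \<rho> (A \<times> B) \<in> W} | A B W.
        A \<in> sets M \<and> B \<in> sets M \<and> open (W :: real set)}"
    by blast
  then show ?thesis unfolding couplings2_topology_def by auto
qed

lemma openin_couplings2_topology:
  assumes "A \<in> sets M" "B \<in> sets M" "open W"
  shows "openin (couplings2_topology M) {\<rho> \<in> couplings2 M. measure \<rho> (A \<times> B) \<in> W}"
  unfolding couplings2_topology_def using assms by (intro topology_generated_by_Basis) blast

lemma lens_in_couplings2:
  assumes [measurable]: "T \<in> measurable M M" and inv: "distr M M T = M" and \<rho>: "\<rho> \<in> couplings2 M"
  shows "lens M T \<rho> \<in> couplings2 M"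
proof -
  have [measurable_cong]: "sets \<rho> = sets (M \<Otimes>\<^sub>M M)" and "prob_space \<rho>"
    and marg: "distr \<rho> M fst = M" "distr \<rho> M snd = M"
    using \<rho> by (auto simp: couplings2_def)
  have "distr (lens M T \<rho>) M fst = distr \<rho> M (T \<circ> fst)"
    unfolding lens_def by (subst distr_distr) (auto simp: comp_def case_prod_beta)
  also have "\<dots> = distr (distr \<rho> M fst) M T" by (subst distr_distr) auto
  finally have fst: "distr (lens M T \<rho>) M fst = M" by (simp add: marg inv)
  have "distr (lens M T \<rho>) M snd = distr \<rho> M (T \<circ> snd)"
    unfolding lens_def by (subst distr_distr) (auto simp: comp_def case_prod_beta)
  also have "\<dots> = distr (distr \<rho> M snd) M T" by (subst distr_distr) auto
  finally have snd: "distr (lens M T \<rho>) M snd = M" by (simp add: marg inv)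
  have "prob_space (lens M T \<rho>)"
    unfolding lens_def by (rule prob_space.prob_space_distr) (fact, measurable)
  then show ?thesis using fst snd by (simp add: couplings2_def) (simp add: lens_def)
qed

text \<open>Moves the iterates from the coupling to the sets: observing \<open>A \<times> A\<close>
  at time \<open>n\<close> is measuring its preimage at time 0.\<close>

lemma measure_lens_funpow:
  assumes T [measurable]: "T \<in> measurable M M" and inv: "distr M M T = M"
    and \<rho>: "\<rho> \<in> couplings2 M" and A: "A \<in> sets M"
  shows "measure ((lens M T ^^ n) \<rho>) (A \<times> A) =
    measure \<rho> (((T ^^ n) -` A \<inter> space M) \<times> ((T ^^ n) -` A \<inter> space M))"
  using \<rho>
proof (induction n arbitrary: \<rho>)
  case 0
  then show ?case using sets.sets_into_space[OF A] by (simp add: Int_absorb2)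
next
  case (Suc n)
  have [measurable_cong]: "sets \<rho> = sets (M \<Otimes>\<^sub>M M)" using Suc.prems by (auto simp: couplings2_def)
  then have space: "space \<rho> = space M \<times> space M"
    by (metis sets_eq_imp_space_eq space_pair_measure)
  define E where "E n = (T ^^ n) -` A \<inter> space M" for n
  have Tn: "T ^^ n \<in> measurable M M" for n by (induction n) (auto simp: id_def[symmetric])
  have [measurable]: "E n \<in> sets M" for n unfolding E_def by (rule measurable_sets[OF Tn A])
  have "measure ((lens M T ^^ Suc n) \<rho>) (A \<times> A) = measure (lens M T \<rho>) (E n \<times> E n)"
    using Suc.IH[OF lens_in_couplings2[OF T inv Suc.prems]] by (simp add: funpow_swap1 E_def)
  also have "\<dots> = measure \<rho> ((\<lambda>(x, y). (T x, T y)) -` (E n \<times> E n) \<inter> space \<rho>)"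
    unfolding lens_def by (rule measure_distr) auto
  also have "(\<lambda>(x, y). (T x, T y)) -` (E n \<times> E n) \<inter> space \<rho> = E (Suc n) \<times> E (Suc n)"
    using measurable_space[OF T] by (auto simp: E_def space funpow_swap1)
  finally show ?case unfolding E_def .
qed

section \<open>Infinite entropy of the lens\<close>

lemma (in partition_process) top_entropy_lens_infinite:
  assumes inv: "distr M M T = M" and h: "0 < ks_entropy_rel M T P"
  shows "top_entropy (couplings2_topology M) (lens M T) = \<infinity>"
proof -
  let ?X = "couplings2_topology M" and ?f = "lens M T"
  obtain B v where B: "B \<in> P" and v: "0 < v" and
    freq: "\<exists>\<^sub>F n in sequentially. v * real n \<le> real (card {i. i < n \<and> v \<le> innovation_var B i})"
    using frequently_many_innovations[OF h] .
  interpret innov: multiplicative_system M "innovation B"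
    by (rule multiplicative_system_innovation[OF B])
  have f: "?f \<in> topspace ?X \<rightarrow> topspace ?X"
    using lens_in_couplings2[OF measurable_T inv] by (auto simp: topspace_couplings2_topology)
  have ne: "topspace ?X \<noteq> {}"
  proof -
    \<comment> \<open>The empty Riesz product, that is, the product measure.\<close>
    have "riesz_coupling M (innovation B) (\<lambda>_. 0) 0 \<in> couplings2 M"
      by (rule innov.riesz_coupling_in_couplings2) auto
    then show ?thesis unfolding topspace_couplings2_topology by blast
  qed
  \<comment> \<open>Here \<open>B\<close> and \<open>v\<close> stay fixed; only the number
    \<open>L\<close> of levels, and with it the fineness of the cover, depends on
    \<open>c\<close>.\<close>
  have "ereal c \<le> top_entropy ?X ?f" for c
  proof -
    obtain L0 :: nat where "exp (c / v) \<le> real L0" using real_arch_simple by blast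
    then obtain L :: nat where L: "exp (c / v) \<le> real L" "0 < L"
      by (metis exp_gt_zero less_le_trans of_nat_0_less_iff)
    then have "c / v \<le> ln (real L)" by (simp add: ln_ge_iff)
    then have c: "c \<le> v * ln (real L)" using v by (simp add: field_simps)
    \<comment> \<open>The separation scale: neighbouring levels differ by \<open>1 / L\<close>, and
      the squared coefficient is at least \<open>v\<^sup>2\<close>.\<close>
    define s where "s = v\<^sup>2 / real L"
    have s: "0 < s" using v L by (simp add: s_def)
    \<comment> \<open>Overlapping open intervals of length \<open>s\<close> centred at the multiples
      of \<open>s / 2\<close>. Those with \<open>k\<close> up to \<open>2 / s\<close> cover [0,1],
      and no two points at distance \<open>s\<close> share one.\<close>
    define W where "W k = {(real k - 1) * (s / 2)<..<(real k + 1) * (s / 2)}" for k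
    define U where "U = (\<lambda>k. {\<rho> \<in> couplings2 M. measure \<rho> (B \<times> B) \<in> W k}) ` {..nat \<lfloor>2 / s\<rfloor>}"
    have close: "y - x < s" if "x \<in> W k" "y \<in> W k" for x y k
      using that by (auto simp: W_def algebra_simps)
    have U: "finite U" "\<Union>U = topspace ?X" "open_cover ?X U"
    proof -
      show "finite U" by (simp add: U_def)
      show cover: "\<Union>U = topspace ?X"
      proof
        show "topspace ?X \<subseteq> \<Union>U"
        proof
          fix \<rho> assume \<rho>: "\<rho> \<in> topspace ?X"
          then have \<rho>2: "\<rho> \<in> couplings2 M" by (simp add: topspace_couplings2_topology)
          then interpret R: prob_space \<rho> by (simp add: couplings2_def)
          define x where "x = measure \<rho> (B \<times> B)"
          define k where "k = nat \<lfloor>2 * x / s\<rfloor>"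
          have x: "0 \<le> x" "x \<le> 1" by (auto simp: x_def)
          have "2 * x / s \<le> 2 / s" using x s by (simp add: divide_right_mono)
          then have "k \<le> nat \<lfloor>2 / s\<rfloor>" unfolding k_def by (intro nat_mono floor_mono)
          moreover have "real k \<le> 2 * x / s" "2 * x / s < real k + 1"
            using x s unfolding k_def by (auto simp: of_nat_nat)
          then have "x \<in> W k" using s by (simp add: W_def field_simps)
          ultimately show "\<rho> \<in> \<Union>U" using \<rho>2 by (auto simp: U_def x_def)
        qed
      qed (auto simp: U_def topspace_couplings2_topology)
      show "open_cover ?X U"
        unfolding open_cover_def
      proof (intro conjI cover ballI)
        fix S assume "S \<in> U"
        then obtain k where "S = {\<rho> \<in> couplings2 M. measure \<rho> (B \<times> B) \<in> W k}" by (auto simp: U_def)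
        then show "openin ?X S"
          using openin_couplings2_topology[OF P_sets[OF B] P_sets[OF B], of "W k"] by (simp add: W_def)
      qed
    qed
    have "c \<le> top_entropy_rel ?X ?f U"
    proof (rule top_entropy_rel_ge[OF f U(1,2) ne])
      show "\<exists>\<^sub>F n in sequentially. c * real n \<le> ln (real (min_subcover ?X (cover_join ?X ?f U n)))"
        using freq
      proof (rule frequently_elim1)
        fix n assume n: "v * real n \<le> real (card {i. i < n \<and> v \<le> innovation_var B i})"
        define J where "J = {i. i < n \<and> v \<le> innovation_var B i}"
        \<comment> \<open>Extensional functions agree off \<open>J\<close>, so different members
          differ at a time in \<open>J\<close>, and there are \<open>L ^ card J\<close> of
          them.\<close>
        define I where "I = (J \<rightarrow>\<^sub>E {..<L})"
        define t where "t k i = (if i \<in> J then real (k i) / real L else 0)" for k i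
        define p where "p k = riesz_coupling M (innovation B) (t k) n" for k
        have t: "0 \<le> t k i" "t k i \<le> 1" if "k \<in> I" for k i
          using that L unfolding t_def I_def by (auto simp: PiE_iff less_imp_le)
        have pc: "p k \<in> couplings2 M" if "k \<in> I" for k
          unfolding p_def by (rule innov.riesz_coupling_in_couplings2) (use t that in auto)
        \<comment> \<open>Stated for the direction \<open>k i < l i\<close> at the first difference
          \<open>i\<close>; the other one follows by exchanging \<open>k\<close> and
          \<open>l\<close>.\<close>
        have sep: False
          if S: "S \<in> cover_join ?X ?f U n" and k: "k \<in> I" "p k \<in> S" and l: "l \<in> I" "p l \<in> S"
            and less: "k i < l i" and agree: "\<And>j. j < i \<Longrightarrow> k j = l j" for S k l i
        proof -
          have i: "i \<in> J" 
            using k(1) l(1) less unfolding I_def by (metis PiE_arb less_irrefl)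
          then have in': "i < n" "v \<le> innovation_var B i" by (auto simp: J_def)
          let ?E = "event B i"
          have "measure (p k) (?E \<times> ?E) + (t l i - t k i) * (innov.coeff ?E {i})\<^sup>2 \<le> measure (p l) (?E \<times> ?E)"
            unfolding p_def
          proof (rule innov.riesz_coupling_separated)
            show "innov.coeff ?E S = 0" if "finite S" "j \<in> S" "i < j" for S j
              by (rule coeff_event_eq_0[OF B that])
            show "t k i \<le> t l i" using less by (simp add: t_def divide_right_mono)
          qed (use t k l in' agree event_sets[OF P_sets[OF B]] in \<open>auto simp: t_def\<close>)
          moreover have "s \<le> (t l i - t k i) * (innov.coeff ?E {i})\<^sup>2"
          proof -
            have "1 / real L \<le> t l i - t k i"
              using less i L by (simp add: t_def field_simps)
            moreover have "v\<^sup>2 \<le> (innov.coeff ?E {i})\<^sup>2"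
              unfolding coeff_event_singleton[OF B] using v in'(2) by (intro power_mono) auto
            ultimately have "1 / real L * v\<^sup>2 \<le> (t l i - t k i) * (innov.coeff ?E {i})\<^sup>2"
              using less by (intro mult_mono) (auto simp: t_def divide_right_mono)
            then show ?thesis by (simp add: s_def)
          qed
          \<comment> \<open>These are the values on \<open>B \<times> B\<close> of the two orbits at
            time \<open>i\<close>, which membership in \<open>S\<close> puts into one common
            interval of length \<open>s\<close>.\<close>
          ultimately have far: "s \<le> measure (p l) (?E \<times> ?E) - measure (p k) (?E \<times> ?E)" by linarith
          obtain g where g: "\<forall>i<n. g i \<in> U" "S = topspace ?X \<inter> (\<Inter>i<n. (?f ^^ i) -` g i)"
            using S unfolding cover_join_def by auto
          have mem: "(?f ^^ i) (p k) \<in> g i" "(?f ^^ i) (p l) \<in> g i"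
            using k(2) l(2) in'(1) by (auto simp: g(2))
          obtain m where m: "g i = {\<rho> \<in> couplings2 M. measure \<rho> (B \<times> B) \<in> W m}"
            using g(1) in'(1) by (auto simp: U_def)
          have "measure (p k) (?E \<times> ?E) \<in> W m" "measure (p l) (?E \<times> ?E) \<in> W m"
            using mem measure_lens_funpow[OF measurable_T inv pc P_sets[OF B], of k i]
              measure_lens_funpow[OF measurable_T inv pc P_sets[OF B], of l i] k(1) l(1)
            by (simp_all add: event_def m)
          from close[OF this] far show False by linarith
        qed
        have "card I \<le> min_subcover ?X (cover_join ?X ?f U n)"
        proof (rule min_subcover_ge_separated[OF finite_cover_join[OF U(1)] Union_cover_join[OF f U(2)]])
          show "p ` I \<subseteq> topspace ?X" using pc by (auto simp: topspace_couplings2_topology)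
          fix S k l
          assume S: "S \<in> cover_join ?X ?f U n" "k \<in> I" "l \<in> I" "p k \<in> S" "p l \<in> S"
          show "k = l"
          proof (rule ccontr)
            assume "k \<noteq> l"
            then have ex: "\<exists>i. k i \<noteq> l i" by auto
            \<comment> \<open>The first difference is needed because
              \<open>riesz_coupling_separated\<close> asks for agreement at all earlier
              indices.\<close>
            define i where "i = (LEAST i. k i \<noteq> l i)"
            have i: "k i \<noteq> l i" unfolding i_def by (rule LeastI_ex[OF ex])
            have agree: "k j = l j" if "j < i" for j using not_less_Least that unfolding i_def by blast
            show False
              using i sep[OF S(1) S(2,4) S(3,5), of i] sep[OF S(1) S(3,5) S(2,4), of i] agree
              by (metis linorder_neqE_nat)
          qed
        qed
        moreover have "card I = L ^ card J" by (simp add: I_def card_PiE J_def)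
        ultimately have "real L ^ card J \<le> real (min_subcover ?X (cover_join ?X ?f U n))"
          by (metis of_nat_le_iff of_nat_power)
        then have "ln (real L ^ card J) \<le> ln (real (min_subcover ?X (cover_join ?X ?f U n)))"
          using L by (intro ln_mono) auto
        moreover have "c * real n \<le> ln (real L ^ card J)"
        proof -
          have "c * real n \<le> v * ln (real L) * real n" using c by (intro mult_right_mono) auto
          also have "\<dots> = (v * real n) * ln (real L)" by simp
          also have "\<dots> \<le> real (card J) * ln (real L)"
            using n L by (intro mult_right_mono) (auto simp: J_def)
          finally show ?thesis using L by (simp add: ln_realpow)
        qed
        ultimately show "c * real n \<le> ln (real (min_subcover ?X (cover_join ?X ?f U n)))" by linarith
      qed
    qed
    also have "ereal (top_entropy_rel ?X ?f U) \<le> top_entropy ?X ?f"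
      unfolding top_entropy_def by (rule SUP_upper) (simp add: U(3))
    finally show ?thesis by simp
  qed
  then show ?thesis by (rule ereal_top)
qed

theorem mainTheorem15:
  fixes \<mu> :: "'a :: polish_space measure" and T :: "'a \<Rightarrow> 'a"
  assumes "prob_space \<mu>" and "sets \<mu> = sets borel"
    and "mp_automorphism \<mu> T"
    and "ergodic \<mu> T"
    and "ks_entropy \<mu> T > 0"
  shows "top_entropy (couplings2_topology \<mu>) (lens \<mu> T) = \<infinity>"
proof -
  obtain P where P: "finite_meas_partition \<mu> P" "0 < ks_entropy_rel \<mu> T P"
    using assms(5) unfolding ks_entropy_def less_SUP_iff by auto
  have T: "T \<in> measurable \<mu> \<mu>" "distr \<mu> \<mu> T = \<mu>"
    using assms(3) by (auto simp: mp_automorphism_def)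
  interpret prob_space \<mu> by fact
  interpret partition_process \<mu> T P by unfold_locales (use T P in auto)
  show ?thesis using top_entropy_lens_infinite[OF T(2) P(2)] .
qed

end
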